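(* For all integers $m,n\ge 1$, every edge 2-coloring of the complete bipartite graph $K_{m,n}$ has a color group of size at least $\left\lceil \frac{mn}{4}\right\rceil$; that is, $\mathrm{OPT}(K_{m,n})\ge \left\lceil\frac14|E(K_{m,n})|\right\rceil=\left\lceil \frac{mn}{4}\right\rceil$.
   Context: An edge 2-coloring of a graph is an assignment of colors to its edges such that each vertex is incident to edges of at most 2 distinct colors. A color group is the set of all edges receiving a given color. $\mathrm{OPT}(G)$ denotes the minimum, over all edge 2-colorings of $G$, of the size of the largest color group. *)

theory Defs
  imports Complex_Main
begin

type_synonym 'a ugraph = "'a set \<times> 'a set set"

abbreviation verts :: "'a ugraph \<Rightarrow> 'a set" where
  "verts G \<equiv> fst G"

abbreviation edges :: "'a ugraph \<Rightarrow> 'a set set" where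
  "edges G \<equiv> snd G"

definition complete_bipartite :: "nat \<Rightarrow> nat \<Rightarrow> (nat + nat) ugraph" where
  "complete_bipartite m n =
     (Inl ` {..<m} \<union> Inr ` {..<n}, {{Inl i, Inr j} | i j. i < m \<and> j < n})"

(* Colorings are total functions on vertex sets; only their values on edges matter. *)
definition edge_2_coloring :: "'a ugraph \<Rightarrow> ('a set \<Rightarrow> 'c) \<Rightarrow> bool" where
  "edge_2_coloring G c \<longleftrightarrow>
     (\<forall>v \<in> verts G. finite (c ` {e \<in> edges G. v \<in> e}) \<and> card (c ` {e \<in> edges G. v \<in> e}) \<le> 2)"

definition color_group :: "'a ugraph \<Rightarrow> ('a set \<Rightarrow> 'c) \<Rightarrow> 'c \<Rightarrow> 'a set set" where
  "color_group G c k = {e \<in> edges G. c e = k}"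

(* Unused colors contribute empty groups, which do not affect the maximum when G has an edge
   and give the value 0 when it has none. *)
definition largest_color_group_size :: "'a ugraph \<Rightarrow> ('a set \<Rightarrow> 'c) \<Rightarrow> nat" where
  "largest_color_group_size G c = Max (range (\<lambda>k. card (color_group G c k)))"

(* Intended for finite graphs, which use only finitely many colors; hence the natural numbers
   suffice as a palette. *)
definition OPT :: "'a ugraph \<Rightarrow> nat" where
  "OPT G = (LEAST s. \<exists>c :: 'a set \<Rightarrow> nat. edge_2_coloring G c \<and> largest_color_group_size G c = s)"

end

theory Submission
  imports Defs
begin

text \<open>
  View a coloring as a matrix in which every row and every column shows at most two colors; any row
  palette meets any column palette. If two rows have disjoint palettes, then every column palette
  lies in their union, so at most four colors occur and the pigeonhole principle applies; likewise
  for columns. Otherwise all palettes intersect pairwise, so either at most three colors occur or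
  some color \<open>a\<close> lies in every palette. In the latter case, if \<open>a\<close> covers less than a quarter of the
  matrix, then in some column more than three quarters of the entries differ from \<open>a\<close>; they all have
  the same color \<open>b\<close>, so their rows show only \<open>a\<close> and \<open>b\<close>. Hence \<open>a\<close> and \<open>b\<close> together cover
  more than three quarters of the matrix.
\<close>

section \<open>Pairwise intersecting palettes\<close>

lemma ex_doubleton_eq_if_card_le_2:
  assumes "finite S" "S \<noteq> {}" "card S \<le> 2"
  shows "\<exists>x y. S = {x, y}"
proof -
  have "card S = 1 \<or> card S = 2"
    using assms by (metis One_nat_def card_0_eq le_Suc_eq le_zero_eq numeral_2_eq_2)
  then show ?thesis
    by (metis card_1_singletonE card_2_iff insert_absorb2)
qed

text \<open>Pairwise intersecting edges of a graph form a star or a triangle; \<open>x = y\<close>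
  is allowed, so one-color palettes are covered.\<close>

lemma pairwise_intersecting_doubletons:
  assumes doubleton: "\<And>S. S \<in> F \<Longrightarrow> \<exists>x y. S = {x, y}"
    and inter: "\<And>S T. S \<in> F \<Longrightarrow> T \<in> F \<Longrightarrow> S \<inter> T \<noteq> {}"
  shows "(\<exists>a. \<forall>S\<in>F. a \<in> S) \<or> (\<exists>x y z. \<Union>F \<subseteq> {x, y, z})"
proof (cases "\<exists>a. \<forall>S\<in>F. a \<in> S")
  case False
  then obtain S where S: "S \<in> F" by blast
  then obtain a b where Sab: "S = {a, b}" using doubleton by blast
  obtain T where T: "T \<in> F" "a \<notin> T" using False by blast
  have "b \<in> T" using inter[OF S T(1)] Sab T(2) by blast
  then obtain c where Tbc: "T = {b, c}" using doubleton[OF T(1)] by blast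
  obtain U where U: "U \<in> F" "b \<notin> U" using False by blast
  have "a \<in> U" "c \<in> U"
    using inter[OF S U(1)] inter[OF T(1) U(1)] U(2) Sab Tbc by auto
  moreover have "a \<noteq> c" using T(2) Tbc by blast
  ultimately have Uac: "U = {a, c}" using doubleton[OF U(1)] by auto
  \<comment> \<open>\<open>S\<close>, \<open>T\<close>, \<open>U\<close> are the sides of a
    triangle. One vertex lies on only two sides, so \<open>V\<close>, which meets all three,
    consists of two vertices.\<close>
  have "V \<subseteq> {a, b, c}" if V: "V \<in> F" for V
  proof -
    obtain x y where "V = {x, y}" using doubleton[OF V] by blast
    then show ?thesis
      using inter[OF V S] inter[OF V T(1)] inter[OF V U(1)] Sab Tbc Uac T(2) U(2) by auto
  qed
  then show ?thesis by blast
qed simp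

section \<open>Color classes of a matrix\<close>

definition cells :: "'a set \<Rightarrow> 'b set \<Rightarrow> ('a \<Rightarrow> 'b \<Rightarrow> 'c) \<Rightarrow> 'c \<Rightarrow> ('a \<times> 'b) set" where
  "cells A B f k = {p \<in> A \<times> B. f (fst p) (snd p) = k}"

lemma finite_cells: "finite A \<Longrightarrow> finite B \<Longrightarrow> finite (cells A B f k)"
  by (simp add: cells_def)

lemma ex_large_cells_if_few_colors:
  assumes fin: "finite A" "finite B"
    and D: "finite D" "card D \<le> d"
    and col: "\<And>i j. i \<in> A \<Longrightarrow> j \<in> B \<Longrightarrow> f i j \<in> D"
  shows "\<exists>k. card A * card B \<le> d * card (cells A B f k)"
proof (rule ccontr)
  assume "\<not> ?thesis"
  then have small: "d * card (cells A B f k) < card A * card B" for k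
    by (simp add: not_le)
  \<comment> \<open>The strict bound forces a nonempty matrix, hence a nonempty \<open>D\<close>, as
    the strict comparison of sums requires.\<close>
  then have pos: "card A * card B > 0"
    using gr_zeroI by fastforce
  then have "D \<noteq> {}"
    using col fin by (auto simp: card_gt_0_iff)
  have "A \<times> B = (\<Union>k\<in>D. cells A B f k)"
    using col by (auto simp: cells_def)
  then have "card A * card B \<le> (\<Sum>k\<in>D. card (cells A B f k))"
    by (metis card_UN_le card_cartesian_product D(1))
  then have "d * (card A * card B) \<le> (\<Sum>k\<in>D. d * card (cells A B f k))"
    by (simp flip: sum_distrib_left)
  also have "\<dots> < (\<Sum>k\<in>D. card A * card B)"
    using small D(1) \<open>D \<noteq> {}\<close> by (intro sum_strict_mono) auto
  also have "\<dots> \<le> d * (card A * card B)"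
    using D(2) by simp
  finally show False by simp
qed

lemma ex_large_cells_if_common_color:
  assumes fin: "finite A" "finite B"
    and row: "\<And>i. i \<in> A \<Longrightarrow> \<exists>b. f i ` B = {a, b}"
    and col: "\<And>j. j \<in> B \<Longrightarrow> \<exists>b. (\<lambda>i. f i j) ` A = {a, b}"
  shows "\<exists>k. card A * card B \<le> 4 * card (cells A B f k)"
proof (rule ccontr)
  assume "\<not> ?thesis"
  then have small: "4 * card (cells A B f k) < card A * card B" for k
    by (simp add: not_le)
  \<comment> \<open>Swapping coordinates allows counting column by column.\<close>
  have "cells A B f a = (\<lambda>(j, i). (i, j)) ` (SIGMA j:B. {i \<in> A. f i j = a})"
    by (auto simp: cells_def image_iff)
  then have "card (cells A B f a) = card (SIGMA j:B. {i \<in> A. f i j = a})"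
    by (simp add: card_image inj_on_def split_beta prod_eq_iff)
  also have "\<dots> = (\<Sum>j\<in>B. card {i \<in> A. f i j = a})"
    using fin by (simp add: card_SigmaI)
  finally have card_a: "card (cells A B f a) = (\<Sum>j\<in>B. card {i \<in> A. f i j = a})" .
  \<comment> \<open>Averaging: a color filling a quarter of each column would fill a quarter of the
    matrix.\<close>
  obtain j where j: "j \<in> B" "4 * card {i \<in> A. f i j = a} < card A"
  proof (rule ccontr)
    assume "\<not> thesis"
    with that have "card A \<le> 4 * card {i \<in> A. f i j = a}" if "j \<in> B" for j
      using that by (meson not_le)
    then have "(\<Sum>j\<in>B. card A) \<le> (\<Sum>j\<in>B. 4 * card {i \<in> A. f i j = a})"
      by (rule sum_mono)
    then have "card A * card B \<le> 4 * card (cells A B f a)"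
      by (simp add: card_a mult.commute flip: sum_distrib_left)
    with small[of a] show False by simp
  qed
  obtain b where b: "(\<lambda>i. f i j) ` A = {a, b}"
    using col[OF j(1)] by blast
  define A' where "A' = {i \<in> A. f i j \<noteq> a}"
  have "f i j' \<in> {a, b}" if "i \<in> A'" "j' \<in> B" for i j'
  proof -
    have i: "i \<in> A" "f i j \<noteq> a" using that by (auto simp: A'_def)
    then have "f i j = b" using b by auto
    moreover obtain c where c: "f i ` B = {a, c}" using row[OF i(1)] by blast
    ultimately have "c = b" using i(2) j(1) by auto
    then show ?thesis using c that(2) by auto
  qed
  then have "A' \<times> B \<subseteq> cells A B f a \<union> cells A B f b"
    unfolding cells_def A'_def by fastforce
  then have "card (A' \<times> B) \<le> card (cells A B f a \<union> cells A B f b)"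
    by (intro card_mono) (simp_all add: finite_cells fin)
  also have "\<dots> \<le> card (cells A B f a) + card (cells A B f b)"
    by (rule card_Un_le)
  finally have "card A' * card B \<le> card (cells A B f a) + card (cells A B f b)"
    by (simp add: card_cartesian_product)
  \<comment> \<open>Two classes below a quarter each cover less than half of the matrix, yet
    \<open>A'\<close> contains more than three quarters of the rows.\<close>
  then have "(2 * card A') * card B < card A * card B"
    using small[of a] small[of b] by linarith
  then have "2 * card A' < card A"
    by simp
  moreover have "card A = card {i \<in> A. f i j = a} + card A'"
    unfolding A'_def using fin(1) by (subst card_Un_disjoint[symmetric]) (auto intro: arg_cong[where f = card])
  ultimately show False using j(2) by linarith
qed

lemma few_colors_if_disjoint_rows:
  assumes row: "\<And>i. i \<in> A \<Longrightarrow> \<exists>x y. f i ` B = {x, y}"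
    and col: "\<And>j. j \<in> B \<Longrightarrow> \<exists>x y. (\<lambda>i. f i j) ` A = {x, y}"
    and disj: "i \<in> A" "i' \<in> A" "f i ` B \<inter> f i' ` B = {}"
  shows "\<exists>D. finite D \<and> card D \<le> 4 \<and> (\<forall>i\<in>A. \<forall>j\<in>B. f i j \<in> D)"
proof -
  obtain x y x' y' where xy: "f i ` B = {x, y}" "f i' ` B = {x', y'}"
    using row disj(1,2) by meson
  have "f l j \<in> {x, y, x', y'}" if "l \<in> A" "j \<in> B" for l j
  proof -
    obtain u v where uv: "(\<lambda>i. f i j) ` A = {u, v}"
      using col[OF \<open>j \<in> B\<close>] by blast
    \<comment> \<open>The entries of column \<open>j\<close> in the two disjoint rows differ, so
      they exhaust its palette \<open>{u, v}\<close>, and \<open>f l j\<close> is one of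
      them.\<close>
    have "f i j \<in> {x, y}" "f i' j \<in> {x', y'}" "f i j \<noteq> f i' j"
      using xy disj(3) \<open>j \<in> B\<close> by blast+
    moreover have "f i j \<in> {u, v}" "f i' j \<in> {u, v}" "f l j \<in> {u, v}"
      using uv disj(1,2) \<open>l \<in> A\<close> by blast+
    ultimately show ?thesis by auto
  qed
  moreover have "card {x, y, x', y'} \<le> 4"
    by (simp add: card_insert_if)
  ultimately show ?thesis
    by (intro exI[of _ "{x, y, x', y'}"]) simp
qed

lemma ex_large_cells:
  assumes fin: "finite A" "finite B" and ne: "A \<noteq> {}" "B \<noteq> {}"
    and row: "\<And>i. i \<in> A \<Longrightarrow> card (f i ` B) \<le> 2"
    and col: "\<And>j. j \<in> B \<Longrightarrow> card ((\<lambda>i. f i j) ` A) \<le> 2"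
  shows "\<exists>k. card A * card B \<le> 4 * card (cells A B f k)"
proof -
  have row2: "\<exists>x y. f i ` B = {x, y}" if "i \<in> A" for i
    using row[OF that] fin ne by (intro ex_doubleton_eq_if_card_le_2) auto
  have col2: "\<exists>x y. (\<lambda>i. f i j) ` A = {x, y}" if "j \<in> B" for j
    using col[OF that] fin ne by (intro ex_doubleton_eq_if_card_le_2) auto
  consider
      (few) D where "finite D" "card D \<le> 4" "\<forall>i\<in>A. \<forall>j\<in>B. f i j \<in> D"
    | (inter) "\<And>i i'. i \<in> A \<Longrightarrow> i' \<in> A \<Longrightarrow> f i ` B \<inter> f i' ` B \<noteq> {}"
        "\<And>j j'. j \<in> B \<Longrightarrow> j' \<in> B \<Longrightarrow> (\<lambda>i. f i j) ` A \<inter> (\<lambda>i. f i j') ` A \<noteq> {}"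
    \<comment> \<open>Disjoint columns are disjoint rows of the transposed matrix.\<close>
    using few_colors_if_disjoint_rows[of A f B, OF row2 col2]
      few_colors_if_disjoint_rows[of B "\<lambda>j i. f i j" A, OF col2 row2] by metis
  then show ?thesis
  proof cases
    case few
    then show ?thesis using ex_large_cells_if_few_colors[OF fin, of D 4 f] by simp
  next
    case inter
    define F where "F = (\<lambda>i. f i ` B) ` A \<union> (\<lambda>j. (\<lambda>i. f i j) ` A) ` B"
    have "(\<exists>a. \<forall>S\<in>F. a \<in> S) \<or> (\<exists>x y z. \<Union>F \<subseteq> {x, y, z})"
    proof (rule pairwise_intersecting_doubletons)
      show "\<exists>x y. S = {x, y}" if "S \<in> F" for S
        using that row2 col2 by (auto simp: F_def)
      \<comment> \<open>A row palette and a column palette share the entry where the row and the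
        column cross.\<close>
      show "S \<inter> T \<noteq> {}" if "S \<in> F" "T \<in> F" for S T
        using that inter unfolding F_def by blast
    qed
    then show ?thesis
    proof (elim disjE exE)
      fix a assume a: "\<forall>S\<in>F. a \<in> S"
      show ?thesis
      proof (rule ex_large_cells_if_common_color[OF fin])
        show "\<exists>b. f i ` B = {a, b}" if "i \<in> A" for i
        proof -
          have "a \<in> f i ` B" using a that by (auto simp: F_def)
          then show ?thesis using row2[OF that] by (metis insert_commute insert_iff singletonD)
        qed
        show "\<exists>b. (\<lambda>i. f i j) ` A = {a, b}" if "j \<in> B" for j
        proof -
          have "a \<in> (\<lambda>i. f i j) ` A" using a that by (auto simp: F_def)
          then show ?thesis using col2[OF that] by (metis insert_commute insert_iff singletonD)
        qed
      qed
    next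
      fix x y z assume "\<Union>F \<subseteq> {x, y, z}"
      then show ?thesis
        by (intro ex_large_cells_if_few_colors[OF fin, of "{x, y, z}"])
          (auto simp: F_def card_insert_if)
    qed
  qed
qed

section \<open>From matrices to complete bipartite graphs\<close>

lemma edges_complete_bipartite:
  "edges (complete_bipartite m n) = (\<lambda>(i, j). {Inl i, Inr j}) ` ({..<m} \<times> {..<n})"
  by (auto simp: complete_bipartite_def image_iff)

text \<open>The tags \<open>Inl\<close> and \<open>Inr\<close> tell the endpoints of an unordered
  edge apart, so edges can be counted as cells.\<close>

lemma inj_on_bipartite_edge: "inj_on (\<lambda>(i, j). {Inl i, Inr j}) X"
  by (auto simp: inj_on_def doubleton_eq_iff)

lemma card_edges_complete_bipartite: "card (edges (complete_bipartite m n)) = m * n"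
  unfolding edges_complete_bipartite
  by (subst card_image[OF inj_on_bipartite_edge]) (simp add: card_cartesian_product)

lemma finite_edges_complete_bipartite: "finite (edges (complete_bipartite m n))"
  by (simp add: edges_complete_bipartite)

lemma card_color_group_complete_bipartite:
  "card (color_group (complete_bipartite m n) c k) =
     card (cells {..<m} {..<n} (\<lambda>i j. c {Inl i, Inr j}) k)"
proof -
  have "color_group (complete_bipartite m n) c k =
      (\<lambda>(i, j). {Inl i, Inr j}) ` cells {..<m} {..<n} (\<lambda>i j. c {Inl i, Inr j}) k"
    unfolding color_group_def edges_complete_bipartite cells_def by force
  then show ?thesis
    by (simp add: card_image[OF inj_on_bipartite_edge])
qed

lemma ex_large_color_group:
  assumes "m \<ge> 1" "n \<ge> 1" and c: "edge_2_coloring (complete_bipartite m n) c"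
  shows "\<exists>k. m * n \<le> 4 * card (color_group (complete_bipartite m n) c k)"
proof -
  let ?E = "edges (complete_bipartite m n)" and ?f = "\<lambda>i j. c {Inl i, Inr j}"
  have row: "card (?f i ` {..<n}) \<le> 2" if "i < m" for i
  proof -
    \<comment> \<open>The edges at a left vertex form a row of the matrix; those at a right vertex
      form a column.\<close>
    have "{e \<in> ?E. Inl i \<in> e} = (\<lambda>j. {Inl i, Inr j}) ` {..<n}"
      using that by (auto simp: complete_bipartite_def)
    then have "?f i ` {..<n} = c ` {e \<in> ?E. Inl i \<in> e}"
      by (simp add: image_image)
    moreover have "Inl i \<in> verts (complete_bipartite m n)"
      using that by (simp add: complete_bipartite_def)
    ultimately show ?thesis using c by (simp add: edge_2_coloring_def)
  qed
  have col: "card ((\<lambda>i. ?f i j) ` {..<m}) \<le> 2" if "j < n" for j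
  proof -
    have "{e \<in> ?E. Inr j \<in> e} = (\<lambda>i. {Inl i, Inr j}) ` {..<m}"
      using that by (auto simp: complete_bipartite_def)
    then have "(\<lambda>i. ?f i j) ` {..<m} = c ` {e \<in> ?E. Inr j \<in> e}"
      by (simp add: image_image)
    moreover have "Inr j \<in> verts (complete_bipartite m n)"
      using that by (simp add: complete_bipartite_def)
    ultimately show ?thesis using c by (simp add: edge_2_coloring_def)
  qed
  have "\<exists>k. card {..<m} * card {..<n} \<le> 4 * card (cells {..<m} {..<n} ?f k)"
    using assms(1,2) row col by (intro ex_large_cells) (auto simp: lessThan_empty_iff)
  then show ?thesis
    by (simp add: card_color_group_complete_bipartite)
qed

section \<open>Largest color groups and the optimum\<close>

lemma card_color_group_le_largest:
  assumes "finite (edges G)"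
  shows "card (color_group G c k) \<le> largest_color_group_size G c"
proof -
  have "card (color_group G c k) \<le> card (edges G)" for k
    using assms by (intro card_mono) (auto simp: color_group_def)
  \<comment> \<open>The palette may be infinite, but the group sizes are bounded by the number of
    edges, so \<open>Max\<close> ranges over a finite set.\<close>
  then have "finite (range (\<lambda>k. card (color_group G c k)))"
    by (intro finite_subset[OF _ finite_atMost[of "card (edges G)"]]) auto
  then show ?thesis
    unfolding largest_color_group_size_def by (intro Max_ge) auto
qed

text \<open>The constant coloring is always admissible, so \<open>LEAST\<close> ranges over a
  nonempty set of naturals.\<close>

lemma OPT_attained:
  "\<exists>c :: 'a set \<Rightarrow> nat. edge_2_coloring G c \<and> largest_color_group_size G c = OPT G"
proof -
  have "edge_2_coloring G (\<lambda>_. 0 :: nat)"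
    by (auto simp: edge_2_coloring_def image_constant_conv)
  then have "\<exists>s. \<exists>c :: 'a set \<Rightarrow> nat. edge_2_coloring G c \<and> largest_color_group_size G c = s"
    by blast
  then show ?thesis
    unfolding OPT_def by (rule LeastI_ex)
qed

theorem theorem5:
  fixes m n :: nat
  assumes "m \<ge> 1" and "n \<ge> 1"
  shows "(\<forall>c :: (nat + nat) set \<Rightarrow> 'c. edge_2_coloring (complete_bipartite m n) c \<longrightarrow>
            (\<exists>k. int (card (color_group (complete_bipartite m n) c k)) \<ge> \<lceil>real (m * n) / 4\<rceil>))
       \<and> int (OPT (complete_bipartite m n)) \<ge> \<lceil>real (card (edges (complete_bipartite m n))) / 4\<rceil>
       \<and> \<lceil>real (card (edges (complete_bipartite m n))) / 4\<rceil> = \<lceil>real (m * n) / 4\<rceil>"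
proof -
  have ceil: "\<lceil>real (m * n) / 4\<rceil> \<le> int s" if "m * n \<le> 4 * s" for s
  proof -
    have "real (m * n) \<le> real (4 * s)" using that by (rule of_nat_mono)
    then show ?thesis by (simp add: ceiling_le_iff)
  qed
  \<comment> \<open>The bound on \<open>OPT\<close> follows from the bound for one optimal coloring
    with natural numbers as colors.\<close>
  obtain c :: "(nat + nat) set \<Rightarrow> nat" where c: "edge_2_coloring (complete_bipartite m n) c"
      "largest_color_group_size (complete_bipartite m n) c = OPT (complete_bipartite m n)"
    using OPT_attained by blast
  obtain k where "m * n \<le> 4 * card (color_group (complete_bipartite m n) c k)"
    using ex_large_color_group[OF assms c(1)] by blast
  also have "\<dots> \<le> 4 * OPT (complete_bipartite m n)"
    using card_color_group_le_largest[OF finite_edges_complete_bipartite] c(2)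
    by (metis mult_le_mono2)
  finally have "\<lceil>real (m * n) / 4\<rceil> \<le> int (OPT (complete_bipartite m n))"
    by (rule ceil)
  then show ?thesis
    using ex_large_color_group[OF assms] ceil
    unfolding card_edges_complete_bipartite by blast
qed

end
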